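(* Let $(X,\mathcal{I})$ be a matroid of rank $K$ on a finite set $X$ and let $f:\mathcal{I}\rightarrow\mathbb{R}$ be a polymatroid function with partial curvature $b(f)\in(0,1]$. Let $g:2^X\rightarrow\mathbb{R}$ be a polymatroid function that agrees with $f$ on $\mathcal{I}$ and satisfies $g(X)-g(X\setminus\{a\})\geq(1-b(f))\,g(\{a\})$ for any $a\in X$, with equality holding for some $a\in X$. Then any greedy solution $G$ to the problem of maximizing $f(M)$ subject to $M\in\mathcal{I}$ satisfies $$\frac{f(G)}{f(O)}\geq\frac{1}{1+b(f)},$$ where $O$ is an optimal solution. In particular, when $(X,\mathcal{I})$ is a uniform matroid, any greedy solution $G$ satisfies $$\frac{f(G)}{f(O)}\geq\frac{1}{b(f)}\left(1-\left(1-\frac{b(f)}{K}\right)^K\right)>\frac{1}{b(f)}\left(1-e^{-b(f)}\right).$$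
   Context: A function $h:\mathcal{J}\rightarrow\mathbb{R}$, where $\mathcal{J}$ is the collection of independent sets of a matroid on $X$ (including $\mathcal{J}=2^X$), is a polymatroid function if $h(\emptyset)=0$, $h$ is monotone ($h(A)\leq h(B)$ for all $A\subseteq B$ with $A,B\in\mathcal{J}$), and $h$ is submodular ($h(A\cup\{j\})-h(A)\geq h(B\cup\{j\})-h(B)$ for all $A\subseteq B$ and $j\in X\setminus B$ with $B\cup\{j\}\in\mathcal{J}$). The partial curvature of $f:\mathcal{I}\rightarrow\mathbb{R}$ is $$b(f)=\max_{j,A:\ j\in A\in\mathcal{I},\ f(\{j\})\neq f(\emptyset)}\left\{1-\frac{f(A)-f(A\setminus\{j\})}{f(\{j\})-f(\emptyset)}\right\}.$$ An optimal solution is a set $O\in\operatorname{argmax}_{M\in\mathcal{I}}f(M)$. A greedy solution is a set $G=\{g_1,\ldots,g_K\}$ of $K$ distinct elements with $g_1\in\operatorname{argmax}_{\{g\}\in\mathcal{I}}f(\{g\})$ and, for $i=2,\ldots,K$, $g_i\in\operatorname{argmax} f(\{g_1,\ldots,g_{i-1},g\})$, the argmax being over $g\in X\setminus\{g_1,\ldots,g_{i-1}\}$ with $\{g_1,\ldots,g_{i-1},g\}\in\mathcal{I}$. The uniform matroid of rank $K$ on $X$ ($K\le|X|$) has $\mathcal{I}=\{S\subseteq X:|S|\leq K\}$. It is assumed that $f(O)>0$, so that the ratios and $b(f)$ are well defined. *)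

theory Defs
  imports Complex_Main
begin

locale matroid =
  fixes X :: "'a set" and I :: "'a set set"
  assumes finite_ground: "finite X"
    and indep_subset_ground: "A \<in> I \<Longrightarrow> A \<subseteq> X"
    and empty_indep: "{} \<in> I"
    and indep_subset: "\<lbrakk>B \<in> I; A \<subseteq> B\<rbrakk> \<Longrightarrow> A \<in> I"
    and augment: "\<lbrakk>A \<in> I; B \<in> I; card A < card B\<rbrakk> \<Longrightarrow> \<exists>x\<in>B - A. insert x A \<in> I"

definition matroid_rank :: "'a set set \<Rightarrow> nat" where
  "matroid_rank I = Max (card ` I)"

definition uniform_indep :: "'a set \<Rightarrow> nat \<Rightarrow> 'a set set" where
  "uniform_indep X K = {S. S \<subseteq> X \<and> card S \<le> K}"

text \<open>
  Real-valued functions on a family of sets are total functions whose values outside the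
  family are arbitrary; all notions below inspect values on the family only.
\<close>

locale polymatroid_function = matroid X J
  for X :: "'a set" and J :: "'a set set" +
  fixes h :: "'a set \<Rightarrow> real"
  assumes empty_zero: "h {} = 0"
    and monotone: "\<lbrakk>A \<in> J; B \<in> J; A \<subseteq> B\<rbrakk> \<Longrightarrow> h A \<le> h B"
    and submodular: "\<lbrakk>A \<subseteq> B; j \<in> X - B; insert j B \<in> J\<rbrakk>
      \<Longrightarrow> h (insert j A) - h A \<ge> h (insert j B) - h B"

definition partial_curvature :: "'a set set \<Rightarrow> ('a set \<Rightarrow> real) \<Rightarrow> real" where
  "partial_curvature I f =
    Max {1 - (f A - f (A - {j})) / (f {j} - f {}) | j A. j \<in> A \<and> A \<in> I \<and> f {j} \<noteq> f {}}"

definition optimal_solution :: "'a set set \<Rightarrow> ('a set \<Rightarrow> real) \<Rightarrow> 'a set \<Rightarrow> bool" where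
  "optimal_solution I f M \<longleftrightarrow> is_arg_max f (\<lambda>S. S \<in> I) M"

text \<open>
  The sequence \<open>s\<close> lists the elements in the order in which they are picked. The first step is the
  case \<open>i = 1\<close>, where the set of previous picks is empty; distinctness of the picks is part of the
  constraint.
\<close>

definition greedy_solution ::
  "'a set \<Rightarrow> 'a set set \<Rightarrow> nat \<Rightarrow> ('a set \<Rightarrow> real) \<Rightarrow> 'a set \<Rightarrow> bool" where
  "greedy_solution X I K f G \<longleftrightarrow>
    (\<exists>s :: nat \<Rightarrow> 'a. G = s ` {1..K} \<and>
      (\<forall>i\<in>{1..K}. is_arg_max (\<lambda>x. f (insert x (s ` {1..<i})))
        (\<lambda>x. x \<in> X - s ` {1..<i} \<and> insert x (s ` {1..<i}) \<in> I) (s i)))"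

lemma matroid_Pow: "finite X \<Longrightarrow> matroid X (Pow X)"
proof
  fix A B :: "'a set"
  assume "finite X" and "A \<in> Pow X" and "B \<in> Pow X" and "card A < card B"
  then have "\<not> B \<subseteq> A"
    by (meson PowD card_mono finite_subset not_less)
  with \<open>A \<in> Pow X\<close> \<open>B \<in> Pow X\<close> show "\<exists>x\<in>B - A. insert x A \<in> Pow X"
    by blast
qed auto

end

theory Submission imports Defs begin

text \<open>
  Let \<open>P\<^sub>i\<close> be the set of the first \<open>i\<close> greedy picks, \<open>d\<^sub>i\<close> the \<open>i\<close>-th greedy gain and \<open>O\<close> an optimal
  solution. Bounding \<open>g (O \<union> P\<^sub>i)\<close> from below by the curvature and from above by submodularity gives
  \[ g(O) + (1 - b) \sum_{j < i,\ t_j \notin O} d_j \le g(P_i) + \sum_{o \in O - P_i} (g(P_i + o) - g(P_i)). \]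
  For a general matroid, take \<open>i = K\<close>: the exchange property matches the elements of \<open>O - G\<close> with the
  picks outside \<open>O\<close> so that each marginal is at most the matched greedy gain. For a uniform matroid,
  each marginal is at most \<open>d\<^sub>i\<close>, and the resulting inequalities for \<open>i < K\<close> are a recurrence for the
  residual \<open>g O - \<Sum>\<^sub>j\<^sub><\<^sub>i c\<^sub>j d\<^sub>j\<close>, where \<open>c\<^sub>j\<close> is \<open>1\<close> if the \<open>j\<close>-th pick is in \<open>O\<close> and \<open>b\<close> otherwise.
\<close>

subsection \<open>The residual recurrence\<close>

text \<open>The share of the residual that \<open>m\<close> further picks are sure to recover when
  \<open>k\<close> optimal elements are missing and every pick falls outside the optimum. For
  positive \<open>b\<close> and \<open>k\<close> it equals \<open>(1 - (1 - b / k) ^ m) / b\<close>;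
  the sum form allows termwise comparison.\<close>

definition gain_ratio :: "real \<Rightarrow> nat \<Rightarrow> nat \<Rightarrow> real" where
  "gain_ratio b k m = (\<Sum>t<m. (1 - b / real k) ^ t) / real k"

lemma gain_ratio_nonneg:
  assumes "0 < b" "b \<le> 1"
  shows "0 \<le> gain_ratio b k m"
proof (cases "k = 0")
  case False
  then have "0 \<le> 1 - b / real k"
    using assms by (simp add: field_simps)
  then show ?thesis
    unfolding gain_ratio_def by (intro divide_nonneg_nonneg sum_nonneg) auto
qed (simp add: gain_ratio_def)

lemma gain_ratio_le_1:
  assumes "0 < b" "b \<le> 1" "m \<le> k"
  shows "gain_ratio b k m \<le> 1"
proof (cases "k = 0")
  case False
  then have "0 \<le> 1 - b / real k" "1 - b / real k \<le> 1"
    using assms by (auto simp: field_simps)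
  then have "(\<Sum>t<m. (1 - b / real k) ^ t) \<le> (\<Sum>t<m. 1)"
    by (intro sum_mono power_le_one)
  also have "\<dots> \<le> real k" using assms by simp
  finally show ?thesis using False by (simp add: gain_ratio_def field_simps)
qed (simp add: gain_ratio_def)

lemma gain_ratio_closed_form:
  assumes "0 < b" "0 < k"
  shows "b * gain_ratio b k m = 1 - (1 - b / real k) ^ m"
  using one_diff_power_eq[of "1 - b / real k" m] by (simp add: gain_ratio_def)

lemma gain_ratio_Suc:
  "gain_ratio b k (Suc m) = gain_ratio b k m + (1 - b / real k) ^ m / real k"
  by (simp add: gain_ratio_def add_divide_distrib)

text \<open>With \<open>p\<close> and \<open>q\<close> the two bases, the claim reads
  \<open>p \<le> (q / p) ^ t\<close>, which Bernoulli reduces to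
  \<open>t * (p - q) \<le> p * (1 - p)\<close>. Since \<open>k * (p - q) = 1 - p\<close>, the bound
  \<open>t \<le> p * k\<close> suffices.\<close>

lemma power_Suc_le_power_pred:
  fixes b :: real
  assumes b: "0 < b" "b \<le> 1" and t: "Suc t \<le> k"
  shows "(1 - b / real (Suc k)) ^ Suc t \<le> (1 - b / real k) ^ t"
proof -
  define p where "p = 1 - b / real (Suc k)"
  define q where "q = 1 - b / real k"
  have k: "real k \<ge> 1" using t by simp
  have p: "p > 0" using b k by (simp add: p_def field_simps)
  have q: "q \<ge> 0" using b k by (simp add: q_def field_simps)
  have kp: "p * real (Suc k) = real (Suc k) - b" by (simp add: p_def field_simps)
  have kq: "q * real k = real k - b" using k by (simp add: q_def field_simps)
  have "(real k * (p - q)) * real (Suc k) = (p * real (Suc k)) * real k - (q * real k) * real (Suc k)"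
    by (simp add: algebra_simps)
  also have "\<dots> = (1 - p) * real (Suc k)"
    unfolding kp kq by (simp add: p_def field_simps)
  finally have diff: "real k * (p - q) = 1 - p"
    by (simp del: of_nat_Suc)
  have "0 \<le> real k * (p - q)" unfolding diff using b by (simp add: p_def)
  then have pq: "0 \<le> p - q" using k by (simp add: zero_le_mult_iff)
  have pb: "p * real k \<ge> real t"
  proof -
    have "p * real k = real k - b * (real k / real (Suc k))"
      by (simp add: p_def field_simps)
    moreover have "b * (real k / real (Suc k)) \<le> 1 * 1"
      using b by (intro mult_mono) auto
    moreover have "real t \<le> real k - 1" using t by simp
    ultimately show ?thesis by linarith
  qed
  have "real t * (p - q) \<le> (p * real k) * (p - q)"
    using pb pq by (intro mult_right_mono)
  also have "\<dots> = p * (1 - p)"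
    using diff by (simp add: mult.assoc)
  finally have "p \<le> 1 + real t * (q / p - 1)"
    using p by (simp add: field_simps)
  also have "\<dots> \<le> (1 + (q / p - 1)) ^ t"
    using p q by (intro Bernoulli_inequality) simp
  finally have "p \<le> (q / p) ^ t" by simp
  then have "p * p ^ t \<le> q ^ t"
    using p by (simp add: power_divide field_simps)
  then show ?thesis by (simp add: p_def q_def)
qed

text \<open>The right side is what is guaranteed when the next pick lies in the optimum, so picks
  outside it are the worst case. After splitting off the first term of the sum, the others compare
  one by one.\<close>

lemma gain_ratio_Suc_Suc_le:
  assumes b: "0 < b" "b \<le> 1" and m: "m \<le> k"
  shows "gain_ratio b (Suc k) (Suc m) \<le>
    1 / real (Suc k) + (1 - 1 / real (Suc k)) * gain_ratio b k m"
proof (cases "k = 0")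
  case False
  have "(\<Sum>t<Suc m. (1 - b / real (Suc k)) ^ t) = 1 + (\<Sum>t<m. (1 - b / real (Suc k)) ^ Suc t)"
    by (simp only: sum.lessThan_Suc_shift power_0)
  also have "\<dots> \<le> 1 + (\<Sum>t<m. (1 - b / real k) ^ t)"
    using m by (intro add_left_mono sum_mono power_Suc_le_power_pred[OF b]) auto
  also have "(\<Sum>t<m. (1 - b / real k) ^ t) = real k * gain_ratio b k m"
    using False by (simp add: gain_ratio_def)
  finally have "gain_ratio b (Suc k) (Suc m) \<le> (1 + real k * gain_ratio b k m) / real (Suc k)"
    unfolding gain_ratio_def by (rule divide_right_mono) simp
  then show ?thesis by (simp add: field_simps)
qed (use m in \<open>simp add: gain_ratio_def\<close>)

text \<open>Here \<open>R i\<close> stands for the residual, \<open>d i\<close> for the gain, and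
  \<open>k i\<close> bounds the number of optimal elements missing before pick \<open>i\<close>. The
  alternatives in \<open>step\<close> are a pick outside and a pick inside the optimum.\<close>

lemma residual_recurrence:
  fixes d R :: "nat \<Rightarrow> real" and k :: "nat \<Rightarrow> nat"
  assumes b: "0 < b" "b \<le> 1"
    and d: "\<And>i. i < K \<Longrightarrow> 0 \<le> d i"
    and R: "\<And>i. i < K \<Longrightarrow> R i \<le> real (k i) * d i"
    and k: "\<And>i. i \<le> K \<Longrightarrow> K - i \<le> k i"
    and step: "\<And>i. i < K \<Longrightarrow> (k (Suc i) = k i \<and> R (Suc i) = R i - b * d i) \<or>
      (Suc (k (Suc i)) = k i \<and> R (Suc i) = R i - d i)"
    and i: "i \<le> K"
  shows "R i * gain_ratio b (k i) (K - i) \<le> (\<Sum>j=i..<K. d j)"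
  using i
proof (induction i rule: inc_induct)
  case base
  show ?case by (simp add: gain_ratio_def)
next
  case (step i)
  then have i: "i < K" by simp
  define m where "m = K - Suc i"
  have m: "K - i = Suc m" "K - Suc i = m"
    using i by (simp_all add: m_def)
  have ki: "0 < k i" "Suc m \<le> k i" using k[of i] i m by auto
  have Rd: "R i / real (k i) \<le> d i"
    using R[OF i] ki by (simp add: field_simps)
  have sum: "(\<Sum>j=i..<K. d j) = d i + (\<Sum>j=Suc i..<K. d j)"
    using i by (simp add: sum.atLeast_Suc_lessThan)
  have IH: "R (Suc i) * gain_ratio b (k (Suc i)) m \<le> (\<Sum>j=Suc i..<K. d j)"
    using step.IH m by simp
  from assms(6)[OF i] show ?case
  proof
    assume *: "k (Suc i) = k i \<and> R (Suc i) = R i - b * d i"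
    let ?q = "(1 - b / real (k i)) ^ m"
    have q: "0 \<le> ?q" using b ki by (intro zero_le_power) (simp add: field_simps)
    have "R i * gain_ratio b (k i) (Suc m) = (R i / real (k i)) * ?q + R i * gain_ratio b (k i) m"
      by (simp add: gain_ratio_Suc algebra_simps)
    also have "\<dots> \<le> d i * ?q + R i * gain_ratio b (k i) m"
      using mult_right_mono[OF Rd q] by simp
    \<comment> \<open>This form of the power exposes the loss \<open>b * d i\<close>, which is
      exactly the drop from \<open>R i\<close> to \<open>R (Suc i)\<close>.\<close>
    also have "?q = 1 - b * gain_ratio b (k i) m"
      using gain_ratio_closed_form[OF b(1) ki(1), of m] by simp
    also have "d i * (1 - b * gain_ratio b (k i) m) + R i * gain_ratio b (k i) m =
        d i + R (Suc i) * gain_ratio b (k (Suc i)) m"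
      unfolding *[THEN conjunct1] *[THEN conjunct2] by (simp add: algebra_simps)
    finally show ?thesis using IH sum m by simp
  next
    assume *: "Suc (k (Suc i)) = k i \<and> R (Suc i) = R i - d i"
    let ?k = "k (Suc i)"
    have mk: "m \<le> ?k" using ki * by simp
    show ?thesis
    \<comment> \<open>Multiplying the comparison of ratios by \<open>R i\<close> needs a nonnegative
      residual; otherwise the left side is at most \<open>0\<close> and the gains are
      nonnegative.\<close>
    proof (cases "R i \<le> 0")
      case True
      have "R i * gain_ratio b (k i) (K - i) \<le> 0"
        using True gain_ratio_nonneg[OF b] by (simp add: mult_nonpos_nonneg)
      also have "0 \<le> (\<Sum>j=i..<K. d j)"
        using d by (intro sum_nonneg) simp
      finally show ?thesis .
    next
      case False
      have "R i * gain_ratio b (k i) (Suc m) \<le>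
          R i * (1 / real (k i) + (1 - 1 / real (k i)) * gain_ratio b ?k m)"
        using False gain_ratio_Suc_Suc_le[OF b mk] * by (intro mult_left_mono) auto
      also have "\<dots> = (R i / real (k i)) * (1 - gain_ratio b ?k m) + R i * gain_ratio b ?k m"
        by (simp add: algebra_simps)
      also have "\<dots> \<le> d i * (1 - gain_ratio b ?k m) + R i * gain_ratio b ?k m"
        using Rd gain_ratio_le_1[OF b mk] by (intro add_right_mono mult_right_mono) auto
      also have "\<dots> = d i + R (Suc i) * gain_ratio b ?k m"
        unfolding *[THEN conjunct2] by (simp add: algebra_simps)
      finally show ?thesis using IH sum m by simp
    qed
  qed
qed

subsection \<open>Marginals of a polymatroid function\<close>

text \<open>Extends submodularity to \<open>x \<in> B\<close>, where the marginal at
  \<open>B\<close> vanishes and monotonicity suffices.\<close>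

lemma (in polymatroid_function) marginal_antimono:
  assumes "J = Pow X" "A \<subseteq> B" "B \<subseteq> X" "x \<in> X"
  shows "h (insert x B) - h B \<le> h (insert x A) - h A"
proof (cases "x \<in> B")
  case True
  have "h A \<le> h (insert x A)"
    using assms by (intro monotone) auto
  then show ?thesis using True by (simp add: insert_absorb)
next
  case False
  then show ?thesis using assms submodular[of A B x] by auto
qed

lemma (in polymatroid_function) union_le_sum_marginals:
  assumes "J = Pow X" "A \<subseteq> X" "B \<subseteq> X"
  shows "h (B \<union> A) \<le> h A + (\<Sum>x\<in>B - A. h (insert x A) - h A)"
proof -
  have *: "h (F \<union> A) \<le> h A + (\<Sum>x\<in>F. h (insert x A) - h A)"
    if "finite F" "F \<subseteq> X" for F
    using that
  proof (induction F rule: finite_induct)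
    case (insert x F)
    have "h (insert x (F \<union> A)) - h (F \<union> A) \<le> h (insert x A) - h A"
      using insert.prems assms by (intro marginal_antimono) auto
    then show ?case using insert by simp
  qed simp
  have "B - A \<subseteq> X" "finite (B - A)"
    using assms finite_ground by (auto intro: finite_subset)
  then show ?thesis using *[of "B - A"] by (simp add: Un_Diff_cancel2)
qed

subsection \<open>Greedy runs\<close>

text \<open>The run is phrased through \<open>g\<close> because sets such as
  \<open>B \<union> picks i\<close> may leave \<open>I\<close>. Picks are numbered from
  \<open>0\<close>, so \<open>t i\<close> follows \<open>i\<close> earlier picks.\<close>

locale greedy_run = matroid X I + polymatroid: polymatroid_function X "Pow X" g
  for X :: "'a set" and I :: "'a set set" and g :: "'a set \<Rightarrow> real" +
  fixes b :: real and K :: nat and t :: "nat \<Rightarrow> 'a"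
  assumes b_pos: "0 < b" and b_le_1: "b \<le> 1"
    and curvature: "a \<in> X \<Longrightarrow> (1 - b) * g {a} \<le> g X - g (X - {a})"
    and pick_fresh: "i < K \<Longrightarrow> t i \<notin> t ` {..<i}"
    and pick_indep: "i < K \<Longrightarrow> insert (t i) (t ` {..<i}) \<in> I"
    and pick_best: "\<lbrakk>i < K; x \<in> X - t ` {..<i}; insert x (t ` {..<i}) \<in> I\<rbrakk>
      \<Longrightarrow> g (insert x (t ` {..<i})) \<le> g (insert (t i) (t ` {..<i}))"
begin

abbreviation picks :: "nat \<Rightarrow> 'a set" where
  "picks i \<equiv> t ` {..<i}"

definition gain :: "nat \<Rightarrow> real" where
  "gain i = g (picks (Suc i)) - g (picks i)"

lemma picks_Suc: "picks (Suc i) = insert (t i) (picks i)"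
  by (simp add: lessThan_Suc)

lemma picks_indep: "i \<le> K \<Longrightarrow> picks i \<in> I"
  using pick_indep[of "i - 1"] picks_Suc[of "i - 1"] empty_indep by (cases i) auto

lemma picks_subset: "i \<le> K \<Longrightarrow> picks i \<subseteq> X"
  using picks_indep indep_subset_ground by blast

lemma pick_in_ground: "i < K \<Longrightarrow> t i \<in> X"
  using picks_subset[of K] by auto

lemma inj_picks: "inj_on t {..<K}"
proof (rule linorder_inj_onI)
  fix i j assume "i < j" "i \<in> {..<K}" "j \<in> {..<K}"
  moreover from \<open>i < j\<close> have "t i \<in> picks j" by simp
  ultimately show "t i \<noteq> t j" using pick_fresh[of j] by (metis lessThan_iff)
qed auto

lemma card_picks: "i \<le> K \<Longrightarrow> card (picks i) = i"
  using inj_picks by (subst card_image) (auto elim: inj_on_subset)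

lemma gain_nonneg: "i < K \<Longrightarrow> 0 \<le> gain i"
  unfolding gain_def using picks_subset[of i] picks_subset[of "Suc i"]
  by (simp add: polymatroid.monotone picks_Suc subset_insertI)

lemma sum_gain: "(\<Sum>j<i. gain j) = g (picks i)"
  by (induction i) (simp_all add: gain_def polymatroid.empty_zero)

section \<open>Curvature bounds along the greedy prefixes\<close>

lemma marginal_ge_gain:
  assumes "i < K" "A \<subseteq> X" "t i \<notin> A"
  shows "(1 - b) * gain i \<le> g (insert (t i) A) - g A"
proof -
  have x: "t i \<in> X" using assms pick_in_ground by simp
  have "gain i \<le> g {t i}"
    using polymatroid.marginal_antimono[of "{}" "picks i" "t i"] picks_subset[of i] x assms
    by (simp add: gain_def picks_Suc polymatroid.empty_zero)
  then have "(1 - b) * gain i \<le> (1 - b) * g {t i}"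
    using b_le_1 by (intro mult_left_mono) auto
  also have "\<dots> \<le> g X - g (X - {t i})" using curvature x by simp
  \<comment> \<open>Among sets avoiding \<open>t i\<close>, its marginal is least at
    \<open>X - {t i}\<close>.\<close>
  also have "\<dots> \<le> g (insert (t i) A) - g A"
    using polymatroid.submodular[of A "X - {t i}" "t i"] assms x by (auto simp: insert_absorb)
  finally show ?thesis .
qed

lemma union_picks_ge:
  assumes "B \<subseteq> X" "i \<le> K"
  shows "g B + (1 - b) * (\<Sum>j<i. if t j \<in> B then 0 else gain j) \<le> g (B \<union> picks i)"
  using assms(2)
proof (induction i)
  case (Suc i)
  then have IH: "g B + (1 - b) * (\<Sum>j<i. if t j \<in> B then 0 else gain j) \<le> g (B \<union> picks i)"
    by simp
  show ?case
  proof (cases "t i \<in> B")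
    case True
    then have "B \<union> picks (Suc i) = B \<union> picks i" by (auto simp: picks_Suc)
    then show ?thesis using IH True by simp
  next
    case False
    then have "(1 - b) * gain i \<le> g (insert (t i) (B \<union> picks i)) - g (B \<union> picks i)"
      using Suc.prems assms(1) picks_subset[of i] pick_fresh[of i]
      by (intro marginal_ge_gain) auto
    then show ?thesis using IH False by (simp add: picks_Suc distrib_left)
  qed
qed simp

lemma residual_le_sum_marginals:
  assumes "B \<subseteq> X" "i \<le> K"
  shows "g B - (\<Sum>j<i. if t j \<in> B then gain j else b * gain j) \<le>
    (\<Sum>x\<in>B - picks i. g (insert x (picks i)) - g (picks i))"
proof -
  \<comment> \<open>All gains together give \<open>g (picks i)\<close>, so this identity lets the
    lower and upper bounds on \<open>g (B \<union> picks i)\<close> be combined.\<close>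
  have "(\<Sum>j<i. if t j \<in> B then gain j else b * gain j) =
      (\<Sum>j<i. gain j) - (1 - b) * (\<Sum>j<i. if t j \<in> B then 0 else gain j)"
    unfolding sum_distrib_left sum_subtractf[symmetric]
    by (intro sum.cong) (auto simp: algebra_simps)
  then show ?thesis
    using union_picks_ge[OF assms] sum_gain[of i]
      polymatroid.union_le_sum_marginals[OF refl picks_subset[OF assms(2)] assms(1)]
    by simp
qed

section \<open>Exchange with the greedy picks and the bound for general matroids\<close>

lemma marginal_le_gain:
  assumes "i < K" "x \<in> X - picks i" "insert x (picks i) \<in> I"
  shows "g (insert x (picks i)) - g (picks i) \<le> gain i"
  using pick_best[OF assms] by (simp add: gain_def picks_Suc)

text \<open>Augmenting \<open>picks i\<close> from \<open>B\<close>, for \<open>i\<close> from \<open>n - 1\<close> down to \<open>0\<close>, matches \<open>B\<close> with the picks.\<close>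

lemma sum_le_sum_gain_exchange:
  fixes w :: "'a \<Rightarrow> real"
  assumes w: "\<And>i x. \<lbrakk>i < K; x \<in> X - picks i; insert x (picks i) \<in> I\<rbrakk> \<Longrightarrow> w x \<le> gain i"
    and "n \<le> K" "B \<in> I" "card B \<le> n"
  shows "(\<Sum>x\<in>B - picks n. w x) \<le> (\<Sum>j<n. if t j \<in> B then 0 else gain j)"
  using assms(2-)
proof (induction n arbitrary: B)
  case 0
  then have "B = {}"
    using finite_ground indep_subset_ground finite_subset by fastforce
  then show ?case by simp
next
  case (Suc n)
  have n: "n < K" "n \<le> K" using Suc.prems by auto
  have BX: "B \<subseteq> X" and fin: "finite B"
    using Suc.prems indep_subset_ground finite_ground finite_subset by blast+
  have fresh: "t n \<notin> picks n" using pick_fresh n by simp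
  \<comment> \<open>Deleting \<open>y\<close> lowers the cardinality for the induction hypothesis;
    as \<open>y\<close> is not among the first \<open>n\<close> picks, no condition
    \<open>t j \<in> B\<close> with \<open>j < n\<close> changes.\<close>
  have reduce: "(\<Sum>x\<in>(B - {y}) - picks n. w x) \<le> (\<Sum>j<n. if t j \<in> B then 0 else gain j)"
    if y: "y \<in> B" "y \<notin> picks n" for y
  proof -
    have "(\<Sum>x\<in>(B - {y}) - picks n. w x) \<le> (\<Sum>j<n. if t j \<in> B - {y} then 0 else gain j)"
      using Suc.prems y fin n indep_subset[of B "B - {y}"] by (intro Suc.IH) auto
    also have "\<dots> = (\<Sum>j<n. if t j \<in> B then 0 else gain j)"
      using y by (intro sum.cong) auto
    finally show ?thesis .
  qed
  show ?case
  proof (cases "t n \<in> B")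
    case True
    have "B - picks (Suc n) = (B - {t n}) - picks n" by (auto simp: picks_Suc)
    then show ?thesis using reduce[OF True fresh] True by simp
  next
    case False
    then have minus: "B - picks (Suc n) = B - picks n" by (auto simp: picks_Suc)
    show ?thesis
    proof (cases "card B \<le> n")
      case True
      then show ?thesis
        using Suc.IH[of B] Suc.prems False minus gain_nonneg[OF n(1)] by simp
    next
      \<comment> \<open>Now \<open>B\<close> has one element more than \<open>picks n\<close>, so
        augmentation supplies a partner \<open>y\<close> for pick \<open>n\<close>.\<close>
      case less: False
      then obtain y where y: "y \<in> B - picks n" "insert y (picks n) \<in> I"
        using augment[of "picks n" B] picks_indep[OF n(2)] card_picks[OF n(2)] Suc.prems by auto
      have "(\<Sum>x\<in>B - picks n. w x) = w y + (\<Sum>x\<in>B - picks n - {y}. w x)"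
        using y fin by (intro sum.remove) auto
      also have "B - picks n - {y} = (B - {y}) - picks n" by blast
      also have "w y + (\<Sum>x\<in>(B - {y}) - picks n. w x) \<le>
          gain n + (\<Sum>j<n. if t j \<in> B then 0 else gain j)"
        using w[OF n(1) _ y(2)] reduce[of y] y BX by (intro add_mono) auto
      finally show ?thesis using False minus by simp
    qed
  qed
qed

lemma greedy_matroid_bound:
  assumes B: "B \<in> I" "card B \<le> K"
  shows "g B \<le> (1 + b) * g (picks K)"
proof -
  have BX: "B \<subseteq> X" using B indep_subset_ground by simp
  have "(\<Sum>x\<in>B - picks K. g (insert x (picks K)) - g (picks K)) \<le>
      (\<Sum>j<K. if t j \<in> B then 0 else gain j)"
  \<comment> \<open>The weight is the marginal at the final set, fixed throughout the induction;
    submodularity bounds it by the marginal at every prefix.\<close>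
  proof (rule sum_le_sum_gain_exchange[OF _ le_refl B])
    fix i x assume *: "i < K" "x \<in> X - picks i" "insert x (picks i) \<in> I"
    have "g (insert x (picks K)) - g (picks K) \<le> g (insert x (picks i)) - g (picks i)"
      using * picks_subset[of K] by (intro polymatroid.marginal_antimono image_mono) auto
    also have "\<dots> \<le> gain i" using * by (rule marginal_le_gain)
    finally show "g (insert x (picks K)) - g (picks K) \<le> gain i" .
  qed
  then have "g B \<le> (\<Sum>j<K. if t j \<in> B then 0 else gain j) +
      (\<Sum>j<K. if t j \<in> B then gain j else b * gain j)"
    using residual_le_sum_marginals[OF BX le_refl] by simp
  also have "\<dots> \<le> (\<Sum>j<K. (1 + b) * gain j)"
    unfolding sum.distrib[symmetric] using gain_nonneg b_pos
    by (intro sum_mono) (auto simp: distrib_right)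
  also have "\<dots> = (1 + b) * g (picks K)"
    by (simp add: sum_distrib_left[symmetric] sum_gain)
  finally show ?thesis .
qed

section \<open>The sharper bound for uniform matroids\<close>

lemma greedy_uniform_bound:
  assumes I: "I = uniform_indep X K" and K: "0 < K" and B: "B \<in> I"
  shows "(1 - (1 - b / real K) ^ K) * g B \<le> b * g (picks K)"
proof -
  have BX: "B \<subseteq> X" and cB: "card B \<le> K" using B I by (auto simp: uniform_indep_def)
  have fin: "finite B" using BX finite_ground finite_subset by blast
  define R where "R i = g B - (\<Sum>j<i. if t j \<in> B then gain j else b * gain j)" for i
  \<comment> \<open>\<open>r i\<close> counts the first \<open>i\<close> picks that hit
    \<open>B\<close>. The recurrence uses \<open>K - r i\<close>, which bounds the number of missing
    elements and is at least \<open>K - i\<close> even when \<open>B\<close> has fewer than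
    \<open>K\<close> elements.\<close>
  define r where "r i = card {j. j < i \<and> t j \<in> B}" for i
  have r_Suc: "r (Suc i) = r i + (if t i \<in> B then 1 else 0)" for i
  proof -
    have "{j. j < Suc i \<and> t j \<in> B} =
        (if t i \<in> B then insert i {j. j < i \<and> t j \<in> B} else {j. j < i \<and> t j \<in> B})"
      by (auto simp: less_Suc_eq)
    then show ?thesis by (simp add: r_def)
  qed
  have r_le: "r i \<le> i" for i
    using card_mono[of "{..<i}" "{j. j < i \<and> t j \<in> B}"] by (auto simp: r_def)
  have R_le: "R i \<le> real (K - r i) * gain i" if i: "i < K" for i
  proof -
    have "R i \<le> (\<Sum>x\<in>B - picks i. g (insert x (picks i)) - g (picks i))"
      unfolding R_def using residual_le_sum_marginals[OF BX] i by simp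
    also have "\<dots> \<le> (\<Sum>x\<in>B - picks i. gain i)"
    \<comment> \<open>As \<open>i < K\<close>, uniformity makes every element outside
      \<open>picks i\<close> a feasible choice.\<close>
    proof (intro sum_mono marginal_le_gain i)
      fix x assume x: "x \<in> B - picks i"
      then show "x \<in> X - picks i" using BX by blast
      then show "insert x (picks i) \<in> I"
        using i card_picks[of i] picks_subset[of i] by (simp add: I uniform_indep_def)
    qed
    also have "\<dots> = real (card (B - picks i)) * gain i" by simp
    also have "card (B - picks i) = card B - card (B \<inter> picks i)"
      using fin by (simp add: card_Diff_subset_Int)
    also have "B \<inter> picks i = t ` {j. j < i \<and> t j \<in> B}" by auto
    also have "card (t ` {j. j < i \<and> t j \<in> B}) = r i"
      unfolding r_def using i by (intro card_image inj_on_subset[OF inj_picks]) auto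
    also have "real (card B - r i) * gain i \<le> real (K - r i) * gain i"
      using cB gain_nonneg[OF i] by (intro mult_right_mono) auto
    finally show ?thesis .
  qed
  have "R 0 * gain_ratio b (K - r 0) (K - 0) \<le> (\<Sum>j=0..<K. gain j)"
  proof (rule residual_recurrence[where k = "\<lambda>i. K - r i", OF b_pos b_le_1 gain_nonneg R_le])
    fix i
    show "K - i \<le> K - r i" using r_le[of i] by simp
    assume "i < K"
    then show "K - r (Suc i) = K - r i \<and> R (Suc i) = R i - b * gain i \<or>
        Suc (K - r (Suc i)) = K - r i \<and> R (Suc i) = R i - gain i"
      using r_le[of i] by (auto simp: R_def r_Suc)
  qed auto
  then have "g B * gain_ratio b K K \<le> g (picks K)"
    by (simp add: R_def r_def sum_gain[symmetric] atLeast0LessThan)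
  then have "b * (g B * gain_ratio b K K) \<le> b * g (picks K)"
    using b_pos by (intro mult_left_mono) auto
  moreover have "b * (g B * gain_ratio b K K) = (b * gain_ratio b K K) * g B" by simp
  ultimately show ?thesis
    using gain_ratio_closed_form[OF b_pos K, of K] by simp
qed

end

text \<open>Strictness comes from \<open>1 - x < exp (- x)\<close> at \<open>x = b / K\<close>,
  raised to the power \<open>K\<close>.\<close>

lemma one_minus_div_power_less_exp:
  fixes b :: real
  assumes "0 < b" "b \<le> 1" "0 < K"
  shows "(1 - b / real K) ^ K < exp (- b)"
proof -
  have nonneg: "0 \<le> 1 - b / real K" using assms by (simp add: field_simps)
  have "1 - b / real K < exp (- (b / real K))"
    using assms exp_minus_greater[of "b / real K"] by simp
  then have "(1 - b / real K) ^ K < exp (- (b / real K)) ^ K"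
    using nonneg assms by (intro power_strict_mono) auto
  also have "\<dots> = exp (- b)"
    using assms by (simp add: exp_of_nat_mult[symmetric])
  finally show ?thesis .
qed

theorem corollary1:
  fixes X :: "'a set" and I :: "'a set set" and K :: nat
    and f g :: "'a set \<Rightarrow> real" and b :: real and G Opt :: "'a set"
  assumes "matroid X I" and "matroid_rank I = K"
    and "polymatroid_function X I f"
    and "b = partial_curvature I f" and "0 < b" and "b \<le> 1"
    and "polymatroid_function X (Pow X) g"
    and "\<forall>A\<in>I. g A = f A"
    and "\<forall>a\<in>X. g X - g (X - {a}) \<ge> (1 - b) * g {a}"
    and "\<exists>a\<in>X. g X - g (X - {a}) = (1 - b) * g {a}"
    and "optimal_solution I f Opt" and "f Opt > 0"
    and "greedy_solution X I K f G"
  shows "f G / f Opt \<ge> 1 / (1 + b) \<and>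
    (I = uniform_indep X K \<longrightarrow>
      f G / f Opt \<ge> (1 / b) * (1 - (1 - b / real K) ^ K) \<and>
      (1 / b) * (1 - (1 - b / real K) ^ K) > (1 / b) * (1 - exp (- b)))"
proof -
  interpret M: matroid X I by fact
  interpret g: polymatroid_function X "Pow X" g by fact
  obtain s where G: "G = s ` {1..K}"
    and s: "\<forall>i\<in>{1..K}. is_arg_max (\<lambda>x. f (insert x (s ` {1..<i})))
        (\<lambda>x. x \<in> X - s ` {1..<i} \<and> insert x (s ` {1..<i}) \<in> I) (s i)"
    using \<open>greedy_solution X I K f G\<close> unfolding greedy_solution_def by blast
  define t where "t i = s (Suc i)" for i
  have ts: "t ` {..<i} = s ` {1..<Suc i}" for i
  proof -
    have "{1..<Suc i} = Suc ` {..<i}"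
      by (simp only: image_Suc_lessThan atLeastLessThanSuc_atLeastAtMost)
    then show ?thesis by (simp only: image_image t_def cong: image_cong)
  qed
  have pick: "is_arg_max (\<lambda>x. f (insert x (t ` {..<i})))
      (\<lambda>x. x \<in> X - t ` {..<i} \<and> insert x (t ` {..<i}) \<in> I) (t i)" if "i < K" for i
    using s[rule_format, of "Suc i"] that unfolding ts by (simp add: t_def)
  have agree: "g A = f A" if "A \<in> I" for A
    using \<open>\<forall>A\<in>I. g A = f A\<close> that by blast
  interpret greedy_run X I g b K t
  proof
    show "0 < b" "b \<le> 1" by fact+
    show "(1 - b) * g {a} \<le> g X - g (X - {a})" if "a \<in> X" for a
      using assms(9) that by blast
    fix i assume i: "i < K"
    show "t i \<notin> t ` {..<i}" "insert (t i) (t ` {..<i}) \<in> I"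
      using pick[OF i] by (auto simp: is_arg_max_linorder)
    fix x assume "x \<in> X - t ` {..<i}" "insert x (t ` {..<i}) \<in> I"
    then show "g (insert x (t ` {..<i})) \<le> g (insert (t i) (t ` {..<i}))"
      using pick[OF i] by (auto simp: is_arg_max_linorder agree)
  qed
  have "G = picks K"
    unfolding G ts by (simp add: atLeastLessThanSuc_atLeastAtMost)
  then have fG: "f G = g (picks K)" using picks_indep agree by simp
  have Opt: "Opt \<in> I" using assms(11) by (simp add: optimal_solution_def is_arg_max_def)
  then have fOpt: "f Opt = g Opt" using agree by simp
  \<comment> \<open>Finiteness makes the \<open>Max\<close> in \<open>matroid_rank\<close> an upper
    bound for \<open>card Opt\<close>.\<close>
  have "finite I"
    using M.indep_subset_ground M.finite_ground by (meson Pow_iff finite_Pow_iff finite_subset subsetI)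
  then have cOpt: "card Opt \<le> K"
    using assms(2) Opt by (auto simp: matroid_rank_def)
  \<comment> \<open>A positive optimum rules out rank \<open>0\<close>, so \<open>b / K\<close> is a
    genuine quotient.\<close>
  have "Opt \<noteq> {}" using \<open>f Opt > 0\<close> fOpt g.empty_zero by auto
  then have K: "0 < K"
    using cOpt M.indep_subset_ground[OF Opt] M.finite_ground finite_subset by fastforce
  have "1 / (1 + b) \<le> f G / f Opt"
    using greedy_matroid_bound[OF Opt cOpt] \<open>f Opt > 0\<close> \<open>0 < b\<close>
    by (simp add: fG fOpt field_simps)
  moreover have "(1 / b) * (1 - (1 - b / real K) ^ K) \<le> f G / f Opt" if "I = uniform_indep X K"
    using greedy_uniform_bound[OF that K Opt] \<open>f Opt > 0\<close> \<open>0 < b\<close>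
    by (simp add: fG fOpt pos_le_divide_eq pos_divide_le_eq mult.commute)
  moreover have "(1 / b) * (1 - exp (- b)) < (1 / b) * (1 - (1 - b / real K) ^ K)"
    using one_minus_div_power_less_exp[OF \<open>0 < b\<close> \<open>b \<le> 1\<close> K] \<open>0 < b\<close>
    by (intro mult_strict_left_mono) auto
  ultimately show ?thesis by blast
qed

end
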